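(* Let $d \in \{2,3,5,6,7,11,13,17,19,21,29,33,37,41,57,73\}$ and let $\mathbb{D}[d]$ be the ring of integers of $\mathbb{Q}(\sqrt{d})$. For every $n \in \mathbb{D}[d] \setminus \{0\}$ there exist nonzero $a, b \in \mathbb{D}[d]$ such that $$\frac{4}{n} = \frac{1}{a} + \frac{1}{b}.$$
   Context: $\mathbb{D}[d]$ equals $\mathbb{Z}[\sqrt{d}]$ if $d \equiv 2,3 \pmod 4$ and $\mathbb{Z}[\tfrac{1+\sqrt{d}}{2}]$ if $d \equiv 1 \pmod 4$. The equation is read in $\mathbb{Q}(\sqrt{d})$. *)

theory Defs
  imports Complex_Main "HOL-Computational_Algebra.Computational_Algebra"
begin

text \<open>
  The field \<open>\<rat>(\<surd>d)\<close> is realised inside the reals, which suffices because only real quadratic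
  fields occur.
\<close>

definition quadratic_field :: "nat \<Rightarrow> real set" where
  "quadratic_field d = {p + q * sqrt (real d) | p q. p \<in> \<rat> \<and> q \<in> \<rat>}"

definition quadratic_integers :: "nat \<Rightarrow> real set" (\<open>\<bbbD>[_]\<close>) where
  "\<bbbD>[d] = {x \<in> quadratic_field d. algebraic_int x}"

lemma sqrt_squarefree_irrational:
  fixes d :: nat
  assumes "squarefree d" "d \<noteq> 1"
  shows "sqrt (real d) \<notin> \<rat>"
proof
  assume "sqrt (real d) \<in> \<rat>"
  moreover have "algebraic_int (sqrt (real d))"
    by (intro algebraic_int_sqrt int_imp_algebraic_int) auto
  ultimately have "sqrt (real d) \<in> \<int>"
    by (rule rational_algebraic_int_is_int[rotated])
  then obtain k where k: "sqrt (real d) = of_int k"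
    by (auto elim: Ints_cases)
  have "real d = real_of_int (k ^ 2)"
    using arg_cong[OF k, of "\<lambda>x. x ^ 2"] by simp
  hence "real d = real (nat \<bar>k\<bar> ^ 2)"
    by simp
  hence dk: "d = nat \<bar>k\<bar> ^ 2"
    by (simp only: of_nat_eq_iff)
  hence "nat \<bar>k\<bar> dvd 1"
    using assms(1) by (intro squarefreeD) auto
  with dk assms(2) show False
    by simp
qed

lemma algebraic_int_quadratic_irrational:
  fixes x s t :: real
  assumes x: "algebraic_int x" "x \<notin> \<rat>"
    and st: "s \<in> \<rat>" "t \<in> \<rat>"
    and root: "x ^ 2 - s * x + t = 0"
  shows "s \<in> \<int>" "t \<in> \<int>"
proof -
  obtain s1 s2 where s: "s2 > 0" "s = of_int s1 / of_int s2"
    using st(1) by (auto elim: Rats_cases')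
  obtain t1 t2 where t: "t2 > 0" "t = of_int t1 / of_int t2"
    using st(2) by (auto elim: Rats_cases')
  define D where "D = s2 * t2"
  define F where "F = [:s2 * t1, - (t2 * s1), D:]"
  have D: "D > 0" using s t by (simp add: D_def)
  hence F0: "F \<noteq> 0" by (auto simp: F_def)
  obtain f where f: "F = smult (content F) f" "content f = 1"
    by (rule content_decompose)
  define c where "c = content F"
  have c: "c \<noteq> 0" using F0 by (simp add: c_def)
  have cf: "c * coeff f 0 = s2 * t1" "c * coeff f 1 = - (t2 * s1)" "c * coeff f 2 = D"
    using arg_cong[OF f(1), of "\<lambda>p. coeff p 0"] arg_cong[OF f(1), of "\<lambda>p. coeff p 1"]
      arg_cong[OF f(1), of "\<lambda>p. coeff p 2"]
    by (simp_all add: F_def c_def numeral_2_eq_2)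
  have "degree F = 2" using D by (simp add: F_def)
  hence degf: "degree f = 2"
    using f(1) c c_def by (metis degree_smult_eq)
  have f_ne: "f \<noteq> 0" using degf by auto
  have fx: "f = [:coeff f 0, coeff f 1, coeff f 2:]"
    using degf by (auto simp: poly_eq_iff coeff_pCons numeral_2_eq_2 coeff_eq_0 split: nat.splits)
  let ?c = "real_of_int c" and ?a = "real_of_int (coeff f 2)"
  have c': "?c \<noteq> 0" using c by simp
  have as: "?a * s = - of_int (coeff f 1)"
  proof -
    have "?c * (?a * s) = of_int (c * coeff f 2) * s" by simp
    also have "\<dots> = of_int (t2 * s1)" using s t by (simp add: cf D_def)
    also have "\<dots> = of_int (- (c * coeff f 1))" by (simp only: cf minus_minus)
    also have "\<dots> = ?c * (- of_int (coeff f 1))" by simp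
    finally show ?thesis using c' by (metis mult_left_cancel)
  qed
  have at: "?a * t = of_int (coeff f 0)"
  proof -
    have "?c * (?a * t) = of_int (c * coeff f 2) * t" by simp
    also have "\<dots> = of_int (s2 * t1)" using s t by (simp add: cf D_def)
    also have "\<dots> = ?c * of_int (coeff f 0)" by (simp flip: cf)
    finally show ?thesis using c' by (metis mult_left_cancel)
  qed
  have froot: "poly (map_poly of_int f) x = 0"
  proof -
    have "poly (map_poly of_int f) x = ?a * x ^ 2 + of_int (coeff f 1) * x + of_int (coeff f 0)"
      by (subst fx) (simp add: map_poly_pCons power2_eq_square algebra_simps)
    also have "\<dots> = ?a * (x ^ 2 - s * x + t)"
      by (simp add: ring_distribs flip: at) (use as in \<open>simp flip: mult.assoc\<close>)
    finally show ?thesis using root by simp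
  qed
  obtain P where P: "poly (map_poly of_int P) x = 0" "lead_coeff P = 1"
    using x(1) by (auto simp: algebraic_int_altdef_ipoly)
  have contP: "content P = 1"
    using content_dvd_coeff[of P "degree P"] P(2) is_unit_content_iff[of P] by metis
  define r where "r = pseudo_mod P f"
  have "\<exists>a q. a \<noteq> 0 \<and> smult a P = f * q + r" and degr: "r = 0 \<or> degree r < degree f"
    using pseudo_mod[of f P] f_ne by (auto simp: r_def)
  then obtain a q where aq: "a \<noteq> 0" "smult a P = f * q + r" by blast
  have hom: "map_poly of_int (p + p') = map_poly of_int p + (map_poly of_int p' :: real poly)"
    "map_poly of_int (p * p') = map_poly of_int p * (map_poly of_int p' :: real poly)"
    for p p' :: "int poly"
    by (auto simp: poly_eq_iff coeff_map_poly coeff_mult)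
  have "poly (map_poly of_int (smult a P)) x = 0"
    using P(1) by (simp add: map_poly_smult)
  hence rroot: "poly (map_poly of_int r) x = 0"
    using froot by (simp add: aq hom)
  have "r = 0"
  proof (rule ccontr)
    assume r: "r \<noteq> 0"
    hence "degree r \<le> 1" using degr degf by simp
    hence rx: "r = [:coeff r 0, coeff r 1:]"
      by (auto simp: poly_eq_iff coeff_pCons coeff_eq_0 split: nat.splits)
    have eq: "of_int (coeff r 0) + of_int (coeff r 1) * x = 0"
      using rroot by (subst (asm) rx) (simp add: map_poly_pCons mult.commute)
    show False
    proof (cases "coeff r 1 = 0")
      case True
      with eq r rx show False by simp
    next
      case False
      hence "x = - of_int (coeff r 0) / of_int (coeff r 1)"
        using eq by (simp add: field_simps add_eq_0_iff)
      hence "x \<in> \<rat>" by simp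
      with x(2) show False by contradiction
    qed
  qed
  hence aP: "smult a P = f * q" using aq by simp
  have "normalize a = content q"
    using arg_cong[OF aP, of content] contP f(2) by (simp add: content_mult)
  hence "a dvd content q" by (metis dvd_refl normalize_dvd_iff)
  hence "[:a:] dvd q" by (simp add: const_poly_dvd_iff_dvd_content)
  then obtain g where "q = [:a:] * g" by (elim dvdE)
  hence "smult a P = smult a (f * g)" using aP by simp
  hence "P = f * g" using aq(1) by (metis smult_cancel)
  hence "lead_coeff f * lead_coeff g = 1" using P(2) by (simp add: lead_coeff_mult)
  hence "coeff f 2 * lead_coeff g = 1" using degf by simp
  hence "coeff f 2 = 1 \<or> coeff f 2 = -1" by (auto simp: zmult_eq_1_iff)
  hence "?a = 1 \<or> ?a = -1" by auto
  hence "s = ?a * (?a * s)" "t = ?a * (?a * t)" by auto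
  moreover have "?a * (?a * s) \<in> \<int>" "?a * (?a * t) \<in> \<int>"
    unfolding as at by (intro Ints_mult Ints_minus Ints_of_int)+
  ultimately show "s \<in> \<int>" "t \<in> \<int>" by metis+
qed

lemma square_dvd_squarefree:
  fixes d u v :: int
  assumes "squarefree d" "coprime u v" "v ^ 2 dvd d * u ^ 2"
  shows "v dvd 1"
proof -
  have "coprime (v ^ 2) (u ^ 2)" using assms(2) by (simp add: coprime_commute)
  hence "v ^ 2 dvd d" using assms(3) by (simp add: coprime_dvd_mult_left_iff)
  thus ?thesis using assms(1) by (rule squarefreeD[rotated])
qed

theorem quadratic_integers_eq:
  fixes d :: nat
  assumes d: "squarefree d" "d \<noteq> 1"
  shows "\<bbbD>[d] = (if d mod 4 = 1
                 then {of_int a + of_int b * ((1 + sqrt (real d)) / 2) | a b. True}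
                 else {of_int a + of_int b * sqrt (real d) | a b. True})"
    (is "_ = (if _ then ?H else ?Z)")
proof -
  let ?w = "sqrt (real d)"
  have w2: "?w * ?w = real d" by simp
  have irr: "?w \<notin> \<rat>" using d by (rule sqrt_squarefree_irrational)
  have sf: "squarefree (int d)"
  proof (rule squarefreeI)
    fix x :: int assume "x ^ 2 dvd int d"
    hence "int (nat \<bar>x\<bar> ^ 2) dvd int d" by simp
    hence "nat \<bar>x\<bar> ^ 2 dvd d" by (simp only: int_dvd_int_iff)
    hence "nat \<bar>x\<bar> dvd 1" using d(1) by (intro squarefreeD)
    thus "x dvd 1" by (simp add: nat_abs_dvd_iff)
  qed
  have in_field: "x \<in> quadratic_field d" if "x = p + q * ?w" "p \<in> \<rat>" "q \<in> \<rat>" for x p q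
    using that by (auto simp: quadratic_field_def)
  have monic: "algebraic_int x" if "x ^ 2 - of_int s * x + of_int t = 0" for x :: real and s t
    unfolding algebraic_int_altdef_ipoly
    by (rule exI[of _ "[:t, - s, 1:]"])
       (use that in \<open>simp add: map_poly_pCons power2_eq_square algebra_simps\<close>)
  have Z: "?Z \<subseteq> \<bbbD>[d]"
  proof
    fix x assume "x \<in> ?Z"
    then obtain a b :: int where x: "x = of_int a + of_int b * ?w" by auto
    have "x ^ 2 - of_int (2 * a) * x + of_int (a ^ 2 - b ^ 2 * int d) = 0"
      using w2 by (simp add: x power2_eq_square algebra_simps)
    hence "algebraic_int x" by (rule monic)
    thus "x \<in> \<bbbD>[d]"
      using in_field[OF x] by (simp add: quadratic_integers_def)
  qed
  have H: "?H \<subseteq> \<bbbD>[d]" if d1: "d mod 4 = 1"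
  proof
    fix x assume "x \<in> ?H"
    then obtain a b :: int where x: "x = of_int a + of_int b * ((1 + ?w) / 2)" by auto
    define m where "m = d div 4"
    have "real d = real (4 * m + 1)" using d1 unfolding m_def by (metis div_mult_mod_eq mult.commute)
    hence dm: "real d = 4 * real m + 1" by simp
    define y where "y = (1 + ?w) / 2"
    have y2: "y * y = y + real m"
      using w2 dm by (simp add: y_def field_simps)
    have xy: "x = of_int a + of_int b * y" by (simp add: x y_def)
    have "x ^ 2 - of_int (2 * a + b) * x + of_int (a ^ 2 + a * b - b ^ 2 * int m) =
      of_int (b ^ 2) * (y * y - y - real m)"
      by (simp add: xy power2_eq_square algebra_simps)
    hence "x ^ 2 - of_int (2 * a + b) * x + of_int (a ^ 2 + a * b - b ^ 2 * int m) = 0"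
      by (simp add: y2)
    hence "algebraic_int x" by (rule monic)
    moreover have "x = (of_int a + of_int b / 2) + (of_int b / 2) * ?w"
      by (simp add: x field_simps)
    hence "x \<in> quadratic_field d" by (rule in_field) auto
    ultimately show "x \<in> \<bbbD>[d]" by (simp add: quadratic_integers_def)
  qed
  have main: "\<exists>A B :: int. 2 * x = of_int A + of_int B * ?w \<and> 4 dvd A ^ 2 - int d * B ^ 2"
    if xD: "x \<in> \<bbbD>[d]" for x
  proof -
    from xD obtain p q where x: "x = p + q * ?w" "p \<in> \<rat>" "q \<in> \<rat>" "algebraic_int x"
      by (auto simp: quadratic_integers_def quadratic_field_def)
    show ?thesis
    proof (cases "q = 0")
      case True
      hence "x \<in> \<int>" using x by (intro rational_algebraic_int_is_int) auto
      then obtain k where "x = of_int k" by (auto elim: Ints_cases)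
      thus ?thesis by (intro exI[of _ "2 * k"] exI[of _ 0]) simp
    next
      case False
      have "x \<notin> \<rat>"
      proof
        assume "x \<in> \<rat>"
        hence "(x - p) / q \<in> \<rat>" using x(2,3) by (intro Rats_divide Rats_diff)
        moreover have "(x - p) / q = ?w" using False x(1) by simp
        ultimately show False using irr by simp
      qed
      moreover have "2 * p \<in> \<rat>" "p ^ 2 - q ^ 2 * real d \<in> \<rat>" using x(2,3) by auto
      moreover have "x ^ 2 - (2 * p) * x + (p ^ 2 - q ^ 2 * real d) = 0"
        using w2 by (simp add: x(1) power2_eq_square algebra_simps)
      ultimately have "2 * p \<in> \<int>" "p ^ 2 - q ^ 2 * real d \<in> \<int>"
        using algebraic_int_quadratic_irrational[OF x(4)] by blast+
      then obtain A N where A: "2 * p = of_int A" and N: "p ^ 2 - q ^ 2 * real d = of_int N"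
        by (auto elim!: Ints_cases)
      have "2 * q \<in> \<rat>" using x by simp
      then obtain u v where uv: "v > 0" "coprime u v" "2 * q = of_int u / of_int v"
        by (elim Rats_cases') auto
      have "real_of_int (int d * u ^ 2) = real d * (2 * q) ^ 2 * of_int v ^ 2"
        using uv by (simp add: power_divide)
      also have "real d * (2 * q) ^ 2 = (2 * p) ^ 2 - 4 * (p ^ 2 - q ^ 2 * real d)"
        by (simp add: power2_eq_square algebra_simps)
      also have "\<dots> * of_int v ^ 2 = real_of_int ((A ^ 2 - 4 * N) * v ^ 2)"
        by (simp add: A N)
      finally have "int d * u ^ 2 = (A ^ 2 - 4 * N) * v ^ 2"
        by (simp only: of_int_eq_iff)
      hence "v dvd 1" using sf uv(2) by (intro square_dvd_squarefree[of "int d" u v]) auto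
      hence "v = 1" using uv(1) by simp
      hence u: "2 * q = of_int u" using uv by simp
      have "real_of_int (A ^ 2 - int d * u ^ 2) = (2 * p) ^ 2 - real d * (2 * q) ^ 2"
        by (simp add: A u)
      also have "\<dots> = 4 * (p ^ 2 - q ^ 2 * real d)"
        by (simp add: power2_eq_square algebra_simps)
      also have "\<dots> = real_of_int (4 * N)" by (simp add: N)
      finally have "A ^ 2 - int d * u ^ 2 = 4 * N" by (simp only: of_int_eq_iff)
      moreover have "2 * x = of_int A + of_int u * ?w"
        by (simp add: x(1) algebra_simps flip: A u)
      ultimately show ?thesis by (metis dvd_triv_left)
    qed
  qed
  have sq_mod: "even k \<and> k ^ 2 mod 4 = 0 \<or> odd k \<and> k ^ 2 mod 4 = 1" for k :: int
  proof (cases "even k")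
    case True
    then obtain m where "k = 2 * m" by (elim evenE)
    thus ?thesis by (simp add: power2_eq_square)
  next
    case False
    then obtain m where "k = 2 * m + 1" by (elim oddE)
    hence "k ^ 2 = 4 * (m ^ 2 + m) + 1" by (simp add: power2_eq_square algebra_simps)
    thus ?thesis using False by presburger
  qed
  show ?thesis
  proof (cases "d mod 4 = 1")
    case True
    have "\<bbbD>[d] \<subseteq> ?H"
    proof
      fix x assume "x \<in> \<bbbD>[d]"
      then obtain A B where AB: "2 * x = of_int A + of_int B * ?w" "4 dvd A ^ 2 - int d * B ^ 2"
        using main by blast
      define m where "m = int (d div 4)"
      have "int d = int (4 * (d div 4) + 1)" using True by (metis div_mult_mod_eq mult.commute)
      hence "int d = 4 * m + 1" by (simp add: m_def)
      hence "A ^ 2 - int d * B ^ 2 = A ^ 2 - B ^ 2 - 4 * (m * B ^ 2)"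
        by (simp add: algebra_simps)
      hence "4 dvd A ^ 2 - B ^ 2" using AB(2) by presburger
      hence "A ^ 2 mod 4 = B ^ 2 mod 4" by presburger
      hence "even (A - B)" using sq_mod[of A] sq_mod[of B] by auto
      then obtain k where "A - B = 2 * k" by (elim evenE)
      hence "A = 2 * k + B" by simp
      hence "x = of_int k + of_int B * ((1 + ?w) / 2)"
        using AB(1) by (simp add: field_simps)
      thus "x \<in> ?H" by blast
    qed
    thus ?thesis using True H by auto
  next
    case False
    have d0: "d mod 4 \<noteq> 0"
    proof
      assume "d mod 4 = 0"
      hence "2 ^ 2 dvd d" by (simp add: mod_eq_0_iff_dvd)
      hence "(2::nat) dvd 1" using d(1) by (intro squarefreeD)
      thus False by simp
    qed
    have "\<bbbD>[d] \<subseteq> ?Z"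
    proof
      fix x assume "x \<in> \<bbbD>[d]"
      then obtain A B where AB: "2 * x = of_int A + of_int B * ?w" "4 dvd A ^ 2 - int d * B ^ 2"
        using main by blast
      have eq: "A ^ 2 mod 4 = ((int d mod 4) * (B ^ 2 mod 4)) mod 4"
        using AB(2) by (simp add: mod_eq_dvd_iff mod_mult_eq)
      have dm: "int d mod 4 = 2 \<or> int d mod 4 = 3"
        using False d0 by presburger
      have "even A \<and> even B" using eq dm sq_mod[of A] sq_mod[of B] by auto
      then obtain k l where "A = 2 * k" "B = 2 * l" by (elim conjE evenE)
      hence "x = of_int k + of_int l * ?w" using AB(1) by simp
      thus "x \<in> ?Z" by blast
    qed
    thus ?thesis using False Z by auto
  qed
qed

end

theory Submission
  imports Defs
begin

text \<open>
  If \<open>\<eta> \<noteq> 1\<close> is a unit of norm \<open>1\<close> with \<open>\<eta> \<equiv> 1 (mod 4)\<close>, then \<open>\<alpha> = (1 - \<eta>) / 4\<close> and its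
  conjugate \<open>\<alpha>' = (1 - \<eta>\<inverse>) / 4\<close> are integral with \<open>1 / \<alpha> + 1 / \<alpha>' = 4\<close>, so \<open>a = n * \<alpha>\<close> and
  \<open>b = n * \<alpha>'\<close> solve the equation for every \<open>n\<close>. Writing \<open>\<alpha> = r + s * \<surd>d\<close> with integers \<open>r\<close> and
  \<open>s\<close>, the condition on the norm of \<open>\<eta>\<close> becomes \<open>r = 2 * (r\<^sup>2 - d * s\<^sup>2)\<close>. A solution comes from the
  Pell equation \<open>x\<^sup>2 - 16 * d * s\<^sup>2 = 1\<close> with the sign of \<open>x\<close> chosen so that \<open>x \<equiv> 1 (mod 4)\<close>, by
  \<open>r = (1 - x) / 4\<close>.
\<close>

text \<open>Serves to show that \<open>a\<close> and \<open>b\<close> are integral. If d = 4m + 1,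
  then y = (1 + sqrt d) / 2 satisfies y^2 = y + m, which reduces the product to the basis 1,
  y.\<close>

lemma quadratic_integers_mult_of_int_sqrt:
  fixes d :: nat and r s :: int
  assumes d: "squarefree d" "d \<noteq> 1" and n: "n \<in> \<bbbD>[d]"
  shows "n * (of_int r + of_int s * sqrt (real d)) \<in> \<bbbD>[d]"
proof (cases "d mod 4 = 1")
  case True
  obtain a b :: int where ab: "n = of_int a + of_int b * ((1 + sqrt (real d)) / 2)"
    using n True by (auto simp: quadratic_integers_eq[OF d])
  define m where "m = int (d div 4)"
  have "real d = real (4 * (d div 4) + 1)"
    using True by (metis div_mult_mod_eq mult.commute)
  then have dm: "real d = 4 * of_int m + 1"
    by (simp add: m_def)
  define y where "y = (1 + sqrt (real d)) / 2"
  have w: "sqrt (real d) = 2 * y - 1"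
    by (simp add: y_def field_simps)
  have "sqrt (real d) * sqrt (real d) = real d"
    by simp
  then have y2: "y * y = y + of_int m"
    using dm by (simp add: y_def field_simps)
  have "n * (of_int r + of_int s * sqrt (real d))
      = of_int (a * r - a * s) + of_int (2 * a * s + b * r - b * s) * y
        + of_int (2 * b * s) * (y * y)"
    unfolding ab w by (simp add: algebra_simps)
  also have "\<dots> = of_int (a * r - a * s + 2 * b * s * m)
      + of_int (2 * a * s + b * r + b * s) * ((1 + sqrt (real d)) / 2)"
    unfolding y2 y_def[symmetric] by (simp add: algebra_simps)
  finally show ?thesis
    unfolding quadratic_integers_eq[OF d] if_P[OF True] by blast
next
  case False
  obtain a b :: int where ab: "n = of_int a + of_int b * sqrt (real d)"
    using n False by (auto simp: quadratic_integers_eq[OF d])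
  have "sqrt (real d) * sqrt (real d) = of_int (int d)"
    by simp
  then have "n * (of_int r + of_int s * sqrt (real d))
      = of_int (a * r + b * s * int d) + of_int (a * s + b * r) * sqrt (real d)"
    unfolding ab by (simp add: algebra_simps)
  then show ?thesis
    unfolding quadratic_integers_eq[OF d] if_not_P[OF False] by blast
qed

text \<open>The number r + s sqrt d has trace 2r and, by the equation for \<open>r\<close>, norm r /
  2; so the trace is four times the norm, which is nonzero.\<close>

lemma four_div_eq_sum_unit_fractions:
  fixes d :: nat and r s :: int
  assumes d: "squarefree d" "d \<noteq> 1"
    and rs: "r \<noteq> 0" "r = 2 * (r ^ 2 - int d * s ^ 2)"
    and n: "n \<in> \<bbbD>[d]" "n \<noteq> 0"
  shows "\<exists>a \<in> \<bbbD>[d]. \<exists>b \<in> \<bbbD>[d]. a \<noteq> 0 \<and> b \<noteq> 0 \<and> 4 / n = 1 / a + 1 / b"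
proof -
  define \<alpha> where "\<alpha> = of_int r + of_int s * sqrt (real d)"
  define \<beta> where "\<beta> = of_int r + of_int (- s) * sqrt (real d)"
  have "\<alpha> * \<beta> = of_int (r ^ 2 - int d * s ^ 2)"
    by (simp add: \<alpha>_def \<beta>_def algebra_simps power2_eq_square)
  then have "2 * (\<alpha> * \<beta>) = of_int (2 * (r ^ 2 - int d * s ^ 2))"
    by simp
  then have norm: "2 * (\<alpha> * \<beta>) = of_int r"
    by (simp only: rs(2)[symmetric])
  have trace: "\<alpha> + \<beta> = 2 * of_int r"
    by (simp add: \<alpha>_def \<beta>_def)
  have nz: "\<alpha> \<noteq> 0" "\<beta> \<noteq> 0"
    using norm rs(1) by auto
  have "1 / (n * \<alpha>) + 1 / (n * \<beta>) = (\<alpha> + \<beta>) / (n * (\<alpha> * \<beta>))"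
    using nz n(2) by (simp add: field_simps)
  also have "\<dots> = 4 * (\<alpha> * \<beta>) / (n * (\<alpha> * \<beta>))"
    unfolding trace norm[symmetric] by simp
  also have "\<dots> = 4 / n"
    using nz by simp
  finally have "4 / n = 1 / (n * \<alpha>) + 1 / (n * \<beta>)" ..
  moreover have "n * \<alpha> \<in> \<bbbD>[d]" "n * \<beta> \<in> \<bbbD>[d]"
    unfolding \<alpha>_def \<beta>_def by (intro quadratic_integers_mult_of_int_sqrt d n(1))+
  moreover have "n * \<alpha> \<noteq> 0" "n * \<beta> \<noteq> 0"
    using nz n(2) by auto
  ultimately show ?thesis
    by blast
qed

text \<open>As 81 = 9^2, a square divisor has root below 9, and every such root above 1 has a prime
  factor 2, 3, 5 or 7.\<close>

lemma squarefree_less_81I: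
  fixes d :: nat
  assumes "0 < d" "d < 81" "\<forall>x \<in> {2, 3, 5, 7}. \<not> x ^ 2 dvd d"
  shows "squarefree d"
proof (rule squarefreeI)
  fix x :: nat
  assume x: "x ^ 2 dvd d"
  have "x ^ 2 < 9 ^ 2"
    using dvd_imp_le[OF x assms(1)] assms(2) by simp
  then have "x < 9"
    by (rule power_less_imp_less_base) simp
  moreover have "x \<noteq> 0"
    using x assms(1) by (intro notI) simp
  moreover have "\<not> y dvd x" if "y \<in> {2, 3, 5, 7}" for y
    using assms(3) that dvd_trans[OF dvd_power_same x] by blast
  then have "\<not> 2 dvd x" "x \<noteq> 3" "x \<noteq> 5" "x \<noteq> 7"
    by (metis dvd_refl insertI1 insertI2)+
  ultimately have "x = 1"
    by presburger
  then show "x dvd 1"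
    by simp
qed

theorem theorem3:
  fixes d :: nat and n :: real
  assumes "d \<in> {2, 3, 5, 6, 7, 11, 13, 17, 19, 21, 29, 33, 37, 41, 57, 73}"
    and "n \<in> \<bbbD>[d]" and "n \<noteq> 0"
  shows "\<exists>a \<in> \<bbbD>[d]. \<exists>b \<in> \<bbbD>[d]. a \<noteq> 0 \<and> b \<noteq> 0 \<and> 4 / n = 1 / a + 1 / b"
proof -
  \<comment> \<open>Triples \<open>(d, r, s)\<close> from Pell solutions with x = 1 - 4r;
    \<open>r\<close> is positive when x had to be taken negative.\<close>
  let ?W = "{(2, -4, 3), (3, 2, 1), (5, -2, 1), (6, -12, 5),
        (7, 32, 12), (11, 50, 15), (13, -162, 45), (17, -8, 2),
        (19, 14450, 3315), (21, 14, 3), (29, -2450, 455), (33, 6, 1),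
        (37, -18, 3), (41, -512, 80), (57, 38, 5), (73, -570312, 66750)} :: (nat \<times> int \<times> int) set"
  have "d \<in> fst ` ?W"
    using assms(1) by simp
  then obtain r s where W: "(d, r, s) \<in> ?W"
    by (elim imageE) (metis prod.collapse)
  have "r \<noteq> 0 \<and> r = 2 * (r ^ 2 - int d * s ^ 2)"
    using W by auto
  moreover have "squarefree d"
    using assms(1) by (intro squarefree_less_81I) auto
  moreover have "d \<noteq> 1"
    using assms(1) by auto
  ultimately show ?thesis
    using assms(2,3) by (intro four_div_eq_sum_unit_fractions) auto
qed

end
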